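(* The algorithm InPlaceInterpol, given in full in the context, is correct: on input $(y_1,\dots,y_n)$ and $(a_1,\dots,a_n)$ in $\mathbb{K}^n$ with the $a_i$ pairwise distinct, it outputs the polynomial $F\in\mathbb{K}[X]$ of size $n$ such that $F(a_i)=y_i$ for $1\le i\le n$. It uses $O(1)$ extra space and at most $$\tfrac12\left(c^2+23c\right)\mathsf{M}(n)\log n+O(\mathsf{M}(n)\log\log n)$$ operations in $\mathbb{K}$, where $c=1+c_{pi}$ and $c_{pi}$ is a constant such that the subroutine PartInterpol has space complexity at most $c_{pi}k$.
   Context: Model. $\mathbb{K}$ is the coefficient field. A size-$n$ polynomial is a polynomial of degree at most $n-1$. A register contains either an element of $\mathbb{K}$ or a pointer to the input or output space. The input space is read-only; the output space is pre-allocated and its registers may be read and written any number of times, so it can hold intermediate results. Extra space means the number of registers used besides input and output. Time is the number of operations in $\mathbb{K}$. Logarithms are in base 2. $\mathsf{M}(n)$ bounds the number of operations in $\mathbb{K}$ to multiply two size-$n$ polynomials, with $\alpha\mathsf{M}(n)\le\mathsf{M}(\alpha n)$ for any constant $\alpha\ge1$. $F_{[a..b[}$ denotes the chunk of $F$ made of its coefficients of degrees $a,\dots,b-1$, and the registers holding them. Algorithm InPlaceInterpol. Input: $(y_1,\dots,y_n)$ and $(a_1,\dots,a_n)$. Output: $F$ of size $n$ with $F(a_i)=y_i$. Required: PartInterpol (below) with space complexity at most $c_{pi}k$. 1. $s\gets0$. 2. While $s<n$ do: (a) $k\gets\lfloor\frac{n-s}{c_{pi}+1}\rfloor$; if $k=0$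 then $k\gets n-s$; (b) $Y\gets(y_1,\dots,y_{n-s})$, $A\gets(a_1,\dots,a_{n-s})$; (c) $F_{[s..s+k[}\gets$ PartInterpol$(F_{[0..s[},Y,A,k)$; (d) $s\gets s+k$. Algorithm PartInterpol$(G,Y,A,k)$. Input: $G\in\mathbb{K}[X]$ of size $s$, $Y=(y_1,\dots,y_{n-s})$ and $A=(a_1,\dots,a_{n-s})$ in $\mathbb{K}^{n-s}$, an integer $k\le n-s$ (assumed, without loss of generality, to divide $n-s$). Output: $H\bmod X^k$, where $F=G+X^sH$ is the unique size-$n$ polynomial of this form with $F(a_i)=y_i$ for $1\le i\le n-s$. Starting from $H_{[0..k[}=0$, for $i=1$ to $(n-s)/k$ do: (1) $U\gets1$, $V\gets1$; $T_i\gets\prod_{j=1+k(i-1)}^{ki}(X-a_j)$ by fast divide-and-conquer; (2) for each $j\ne i$, $1\le j\le(n-s)/k$: compute $T_j\gets\prod_{t=1+k(j-1)}^{kj}(X-a_t)$ by fast divide-and-conquer, then $U\gets U\,T_j\bmod X^k$ and $V\gets V\,T_j\bmod T_i$; (3) $G^T\gets G\bmod T_i$; (4) $(b_1,\dots,b_k)\gets$ Eval$(V,a_{1+k(i-1)},\dots,a_{ki})$ and $(z_1,\dots,z_k)\gets$ Eval$(G^T,a_{1+k(i-1)},\dots,a_{ki})$; (5) for $j=1$ to $k$: $b_j\gets(y_{j+k(i-1)}-z_j)/(a_{j+k(i-1)}^{s}\,b_j)$; (6) $N_i\gets$ the size-$k$ polynomial interpolating the values $(b_1,\dots,b_k)$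 at the points $(a_{1+k(i-1)},\dots,a_{ki})$, by Interpol; (7) $H_{[0..k[}\gets H_{[0..k[}+N_iU\bmod X^k$. Here Eval evaluates a size-$k$ polynomial at $k$ points in $\frac72\mathsf{M}(k)\log k+O(\mathsf{M}(k))$ operations and $k+O(k/\log k)$ extra registers, and Interpol interpolates a size-$k$ polynomial at $k$ points in $5\mathsf{M}(k)\log k+O(\mathsf{M}(k)\log\log k)$ operations and $2k+O(k/\log k)$ extra registers. With these, PartInterpol uses $6k+O(k/\log k)$ extra space and $\left(\frac12(\frac{n-s}{k})^2+\frac{23}{2}\frac{n-s}{k}\right)\mathsf{M}(k)\log k+(n-s)\log s+O\left((\frac{n-s}{k})^2\mathsf{M}(k)\log\log k\right)$ operations in $\mathbb{K}$.
   Formalization: Added: a_i ≠ 0 for i ≤ n−k_1, with k_1 the size of the first chunk (otherwise step (5) divides by zero), and n log n = O(M(n) log log n) (otherwise the (n−s) log s terms of PartInterpol break the claimed bound). *)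

theory Defs
  imports
    "HOL-Computational_Algebra.Polynomial"
    "HOL-Library.Landau_Symbols"
    "HOL-Library.While_Combinator"
begin

definition has_size :: "nat \<Rightarrow> 'a::zero poly \<Rightarrow> bool" where
  "has_size n p \<longleftrightarrow> p = 0 \<or> degree p < n"

definition interpolates :: "'a::comm_semiring_0 poly \<Rightarrow> 'a list \<Rightarrow> 'a list \<Rightarrow> bool" where
  "interpolates p as bs \<longleftrightarrow> length as = length bs \<and> (\<forall>i<length as. poly p (as ! i) = bs ! i)"

definition interpol :: "'a::field list \<Rightarrow> 'a list \<Rightarrow> 'a poly" where
  "interpol as bs = (THE N. has_size (length as) N \<and> interpolates N as bs)"


section \<open>The function computed by PartInterpol\<close>

text \<open>
  Blocks are numbered from 0. If \<open>k\<close> does not divide the number of points, the last block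
  consists of the remaining (fewer than \<open>k\<close>) points; otherwise all blocks have length \<open>k\<close>.
\<close>

definition block :: "nat \<Rightarrow> 'b list \<Rightarrow> nat \<Rightarrow> 'b list" where
  "block k xs i = take k (drop (k * i) xs)"

definition num_blocks :: "nat \<Rightarrow> 'b list \<Rightarrow> nat" where
  "num_blocks k xs = (length xs + k - 1) div k"

definition block_poly :: "nat \<Rightarrow> 'a::field list \<Rightarrow> nat \<Rightarrow> 'a poly" where
  "block_poly k as i = prod_list (map (\<lambda>a. [:- a, 1:]) (block k as i))"

text \<open>
  One iteration of the main loop: \<open>g\<close> is the coefficient list of \<open>G\<close>, so the size \<open>s\<close> of \<open>G\<close> is
  \<open>length g\<close>; \<open>H\<close> is the value accumulated so far.
\<close>

definition part_interpol_step ::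
    "'a::field list \<Rightarrow> 'a list \<Rightarrow> 'a list \<Rightarrow> nat \<Rightarrow> nat \<Rightarrow> 'a poly \<Rightarrow> 'a poly" where
  "part_interpol_step g ys as k i H =
    (let T = block_poly k as;
         (U, V) = fold (\<lambda>j (U, V). (U * T j mod monom 1 k, V * T j mod T i))
                    (filter (\<lambda>j. j \<noteq> i) [0..<num_blocks k as]) (1, 1);
         GT = Poly g mod T i;
         A = block k as i;
         b = map (poly V) A;
         z = map (poly GT) A;
         b' = map (\<lambda>j. (block k ys i ! j - z ! j) / (A ! j ^ length g * b ! j)) [0..<length A];
         N = interpol A b'
     in (H + N * U) mod monom 1 k)"

definition part_interpol :: "'a::field list \<Rightarrow> 'a list \<Rightarrow> 'a list \<Rightarrow> nat \<Rightarrow> 'a poly" where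
  "part_interpol g ys as k = fold (part_interpol_step g ys as k) [0..<num_blocks k as] 0"


section \<open>Registers and subroutines\<close>

datatype 'a cell = Elem 'a | Ptr nat

datatype loc = Inp nat | Out nat | Ext nat

type_synonym 'a mem = "loc \<Rightarrow> 'a cell"

text \<open>
  A subroutine implementing PartInterpol receives, by reference, the registers that hold the
  coefficients of \<open>G\<close>, the values and the points, then the \<open>k\<close> registers for its result and the
  registers it may use as work space. It returns the new memory and the number of operations
  in \<open>\<bbbK>\<close> it has performed.
\<close>

type_synonym 'a part_interpol_sub =
  "loc list \<Rightarrow> loc list \<Rightarrow> loc list \<Rightarrow> loc list \<Rightarrow> loc list \<Rightarrow> 'a mem \<Rightarrow> 'a mem \<times> nat"

text \<open>
  Admissible calls with \<open>\<lfloor>c_pi * k\<rfloor>\<close> registers of work space (with arbitrary initial content).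
  The last condition expresses that \<open>F = G + X\<^sup>s H\<close> is uniquely determined by the values:
  if \<open>s > 0\<close>, the value of \<open>F\<close> at \<open>0\<close> says nothing about \<open>H\<close>.
\<close>

definition part_interpol_call ::
    "real \<Rightarrow> loc list \<Rightarrow> loc list \<Rightarrow> loc list \<Rightarrow> loc list \<Rightarrow> loc list \<Rightarrow> 'a::field mem \<Rightarrow>
     'a list \<Rightarrow> 'a list \<Rightarrow> 'a list \<Rightarrow> nat \<Rightarrow> bool" where
  "part_interpol_call c_pi gl yl al ol wl \<sigma> g ys as k \<longleftrightarrow>
     map \<sigma> gl = map Elem g \<and> map \<sigma> yl = map Elem ys \<and> map \<sigma> al = map Elem as \<and>
     length ol = k \<and> length wl = nat \<lfloor>c_pi * real k\<rfloor> \<and>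
     distinct (ol @ wl) \<and> set (ol @ wl) \<inter> set (gl @ yl @ al) = {} \<and>
     set (ol @ wl) \<inter> range Inp = {} \<and>
     length ys = length as \<and> 1 \<le> k \<and> k \<le> length as \<and>
     distinct as \<and> (g \<noteq> [] \<longrightarrow> 0 \<notin> set as)"

definition implements_part_interpol :: "real \<Rightarrow> 'a::field part_interpol_sub \<Rightarrow> bool" where
  "implements_part_interpol c_pi P \<longleftrightarrow>
     (\<forall>gl yl al ol wl \<sigma> g ys as k. part_interpol_call c_pi gl yl al ol wl \<sigma> g ys as k \<longrightarrow>
        (let \<sigma>' = fst (P gl yl al ol wl \<sigma>) in
           map \<sigma>' ol = map (\<lambda>j. Elem (coeff (part_interpol g ys as k) j)) [0..<k] \<and>
           (\<forall>l. l \<notin> set (ol @ wl) \<longrightarrow> \<sigma>' l = \<sigma> l)))"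

text \<open>
  Below, \<open>m\<close> is \<open>n - s\<close>. The maximum with 1 only makes the \<open>O\<close>-term meaningful for \<open>k \<le> 3\<close>,
  where \<open>log (log k) < 1\<close> (or is undefined).
\<close>

definition part_interpol_time ::
    "real \<Rightarrow> (nat \<Rightarrow> real) \<Rightarrow> 'a::field part_interpol_sub \<Rightarrow> bool" where
  "part_interpol_time c_pi M P \<longleftrightarrow>
     (\<exists>C. \<forall>gl yl al ol wl \<sigma> g ys as k. part_interpol_call c_pi gl yl al ol wl \<sigma> g ys as k \<longrightarrow>
        (let s = real (length g); m = real (length as); r = m / real k in
           real (snd (P gl yl al ol wl \<sigma>)) \<le>
             (1/2 * r^2 + 23/2 * r) * M k * log 2 (real k) + m * log 2 s
             + C * (r^2 * M k * max 1 (log 2 (log 2 (real k))))))"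


section \<open>InPlaceInterpol\<close>

text \<open>
  \<open>extra_regs\<close> collects the indices of all extra registers used so far (including those
  lent to the subroutine as work space).
\<close>

record 'a state =
  memory :: "'a mem"
  ops :: nat
  extra_regs :: "nat set"

definition get_ptr :: "nat \<Rightarrow> 'a state \<Rightarrow> nat" where
  "get_ptr r st = (case memory st (Ext r) of Ptr v \<Rightarrow> v | Elem _ \<Rightarrow> undefined)"

definition put_ptr :: "nat \<Rightarrow> nat \<Rightarrow> 'a state \<Rightarrow> 'a state" where
  "put_ptr r v st = st\<lparr>memory := (memory st)(Ext r := Ptr v),
                       extra_regs := insert r (extra_regs st)\<rparr>"

definition call_sub ::
    "'a part_interpol_sub \<Rightarrow> loc list \<Rightarrow> loc list \<Rightarrow> loc list \<Rightarrow> loc list \<Rightarrow> loc list \<Rightarrow>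
     'a state \<Rightarrow> 'a state" where
  "call_sub P gl yl al ol wl st =
     (let (\<sigma>', t) = P gl yl al ol wl (memory st) in
        st\<lparr>memory := \<sigma>', ops := ops st + t,
           extra_regs := extra_regs st \<union> {j. Ext j \<in> set wl}\<rparr>)"

definition chunk_size :: "real \<Rightarrow> nat \<Rightarrow> nat" where
  "chunk_size c_pi m = (let k = nat \<lfloor>real m / (c_pi + 1)\<rfloor> in if k = 0 then m else k)"

text \<open>
  The values are in \<open>Inp 0, \<dots>, Inp (n - 1)\<close>, the points in \<open>Inp n, \<dots>, Inp (2 * n - 1)\<close>, and
  the output space is \<open>Out 0, \<dots>, Out (n - 1)\<close>. The variables \<open>s\<close> and \<open>k\<close> live in \<open>Ext 0\<close> and
  \<open>Ext 1\<close>. The work space of the subroutine is taken from the part of the output space that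
  is not yet in use; only if that is too small, further extra registers are used.
\<close>

definition work_space :: "real \<Rightarrow> nat \<Rightarrow> nat \<Rightarrow> nat \<Rightarrow> loc list" where
  "work_space c_pi n s k =
     (let w = nat \<lfloor>c_pi * real k\<rfloor> in take w (map Out [s + k..<n] @ map Ext [2..<2 + w]))"

definition in_place_interpol_body ::
    "real \<Rightarrow> 'a::field part_interpol_sub \<Rightarrow> nat \<Rightarrow> 'a state \<Rightarrow> 'a state" where
  "in_place_interpol_body c_pi P n st =
     (let s = get_ptr 0 st;
          st1 = put_ptr 1 (chunk_size c_pi (n - s)) st;
          k = get_ptr 1 st1;
          st2 = call_sub P (map Out [0..<s]) (map Inp [0..<n - s]) (map Inp [n..<n + (n - s)])
                  (map Out [s..<s + k]) (work_space c_pi n s k) st1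
      in put_ptr 0 (s + k) st2)"

definition in_place_interpol ::
    "real \<Rightarrow> 'a::field part_interpol_sub \<Rightarrow> nat \<Rightarrow> 'a mem \<Rightarrow> 'a state option" where
  "in_place_interpol c_pi P n \<sigma> =
     while_option (\<lambda>st. get_ptr 0 st < n) (in_place_interpol_body c_pi P n)
       (put_ptr 0 0 \<lparr>memory = \<sigma>, ops = 0, extra_regs = {}\<rparr>)"

definition holds_input :: "nat \<Rightarrow> 'a list \<Rightarrow> 'a list \<Rightarrow> 'a mem \<Rightarrow> bool" where
  "holds_input n ys as \<sigma> \<longleftrightarrow>
     length ys = n \<and> length as = n \<and>
     (\<forall>i<n. \<sigma> (Inp i) = Elem (ys ! i)) \<and> (\<forall>i<n. \<sigma> (Inp (n + i)) = Elem (as ! i))"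

definition holds_output :: "nat \<Rightarrow> 'a::zero poly \<Rightarrow> 'a mem \<Rightarrow> bool" where
  "holds_output n F \<sigma> \<longleftrightarrow> (\<forall>j<n. \<sigma> (Out j) = Elem (coeff F j))"

end

(*
  Let T_i be the polynomial vanishing on the i-th block of points and R_i the product of the T_j
  with j distinct from i. The N_i are chosen so that the sum of the N_i R_i takes the values of H at
  all points; its size is the number of points, so it equals H, and PartInterpol computes it
  modulo X^k. Applied to G = F mod X^s, this yields the next chunk of the interpolating polynomial F.

  Every chunk has n - s <= c k + c, where c = 1 + c_pi, and either c_pi k <= n - s - k, so that the
  work space fits into the unused output, or k = n - s < c, so that a constant number of extra
  registers suffices.

  For the operation count, superlinearity gives M(k) <= (k/n) M(n), so a chunk of size k costs at
  most k Q, where Q depends on n only. As the sizes add up to n, the total is at most n Q. Here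
  (n - s)/k <= c (1 + 1/k), and the excess over c is absorbed by log k <= k.
*)

theory Submission
  imports Defs
begin

section \<open>Existence and uniqueness of the interpolating polynomial; remainders at roots and
  modulo X^k\<close>

section \<open>Interpolating polynomials\<close>

text \<open>Otherwise \<open>p - q\<close> would be a nonzero polynomial with more roots than its
  degree allows.\<close>

lemma interpolates_unique:
  fixes p q :: "'a::idom poly"
  assumes "distinct as" "has_size (length as) p" "has_size (length as) q"
    and "\<And>a. a \<in> set as \<Longrightarrow> poly p a = poly q a"
  shows "p = q"
proof (rule ccontr)
  assume "p \<noteq> q"
  then have nz: "p - q \<noteq> 0" by simp
  have "length as = card (set as)" using assms(1) by (simp add: distinct_card)
  also have "\<dots> \<le> card {x. poly (p - q) x = 0}"
    using poly_roots_finite[OF nz] assms(4) by (intro card_mono) auto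
  also have "\<dots> \<le> degree (p - q)" using nz by (rule card_poly_roots_bound)
  finally have le: "length as \<le> degree (p - q)" .
  moreover have "degree (p - q) < length as"
  proof (cases "p = 0 \<or> q = 0")
    case True
    then show ?thesis using assms(2,3) nz by (auto simp: has_size_def)
  next
    case False
    then show ?thesis using assms(2,3) degree_diff_le_max[of p q] by (auto simp: has_size_def)
  qed
  ultimately show False by simp
qed

text \<open>Newton's incremental construction: for a new point \<open>x\<close>, a multiple of the
  polynomial \<open>T\<close> vanishing on the old points corrects the value at \<open>x\<close>
  without disturbing the others.\<close>

lemma interpolating_poly_exists:
  fixes f :: "'a::field \<Rightarrow> 'a"
  assumes "finite A"
  shows "\<exists>p. has_size (card A) p \<and> (\<forall>a\<in>A. poly p a = f a)"
  using assms
proof induction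
  case empty
  show ?case by (intro exI[of _ 0]) (simp add: has_size_def)
next
  case (insert x A)
  then obtain p where p: "has_size (card A) p" "\<And>a. a \<in> A \<Longrightarrow> poly p a = f a" by blast
  define T where "T = (\<Prod>a\<in>A. [:- a, 1:])"
  define q where "q = p + smult ((f x - poly p x) / poly T x) T"
  have T0: "poly T a = 0" if "a \<in> A" for a
    using that insert(1) by (auto simp: T_def poly_prod)
  have Tx: "poly T x \<noteq> 0"
    using insert(1,2) by (auto simp: T_def poly_prod)
  have "degree T = card A"
    unfolding T_def by (subst degree_prod_sum_eq) auto
  then have "degree q < card (insert x A)"
    using p(1) insert(1,2) unfolding q_def has_size_def
    by (intro degree_add_less) auto
  moreover have "poly q a = f a" if "a \<in> insert x A" for a
    using that p(2) T0 Tx by (auto simp: q_def)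
  ultimately show ?case by (auto simp: has_size_def)
qed

lemma interpolates_exists:
  fixes as bs :: "'a::field list"
  assumes "distinct as" "length as = length bs"
  shows "\<exists>p. has_size (length as) p \<and> interpolates p as bs"
proof -
  \<comment> \<open>As the points are distinct, \<open>map_of\<close> turns the two lists into a
    function sending each point to its own value.\<close>
  obtain p where p: "has_size (card (set as)) p"
    "\<forall>a\<in>set as. poly p a = the (map_of (zip as bs) a)"
    using interpolating_poly_exists[of "set as" "\<lambda>a. the (map_of (zip as bs) a)"] by auto
  have "poly p (as ! i) = bs ! i" if "i < length as" for i
    using p(2) that assms by (simp add: map_of_zip_nth)
  then show ?thesis using p(1) assms by (auto simp: interpolates_def distinct_card)
qed

lemma interpolates_unique_list:
  fixes p q :: "'a::idom poly"
  assumes "distinct as" "has_size (length as) p" "has_size (length as) q"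
    "interpolates p as bs" "interpolates q as bs"
  shows "p = q"
  by (rule interpolates_unique[OF assms(1-3)])
    (use assms(4,5) in \<open>auto simp: interpolates_def in_set_conv_nth\<close>)

lemma interpol_correct:
  fixes as bs :: "'a::field list"
  assumes "distinct as" "length as = length bs"
  shows "has_size (length as) (interpol as bs) \<and> interpolates (interpol as bs) as bs"
  unfolding interpol_def
proof (rule theI')
  show "\<exists>!N. has_size (length as) N \<and> interpolates N as bs"
    using interpolates_exists[OF assms] interpolates_unique_list[OF assms(1)] by blast
qed

text \<open>This is why V and G may be reduced modulo T_i before being evaluated at the points of
  block i.\<close>

lemma poly_mod_root:
  fixes p q :: "'a::field poly"
  assumes "poly q a = 0"
  shows "poly (p mod q) a = poly p a"
proof -
  have "poly p a = poly (p div q * q + p mod q) a" by simp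
  also have "\<dots> = poly (p mod q) a" unfolding poly_add poly_mult using assms by simp
  finally show ?thesis by simp
qed

lemma coeff_mod_monom:
  fixes p :: "'a::field poly"
  assumes "j < k"
  shows "coeff (p mod monom 1 k) j = coeff p j"
proof -
  have "coeff p j = coeff (monom 1 k * (p div monom 1 k) + p mod monom 1 k) j" by simp
  also have "\<dots> = coeff (p mod monom 1 k) j"
    unfolding coeff_add coeff_monom_mult using assms by simp
  finally show ?thesis by simp
qed

section \<open>A Lagrange-type formula over blocks of points and its truncation modulo X^k\<close>

section \<open>Correctness of PartInterpol\<close>

lemma concat_blocks: "concat (map (block k xs) [0..<q]) = take (k * q) xs"
  by (induction q) (simp_all add: block_def take_add[symmetric] add.commute)

lemma num_blocks_cover:
  assumes "1 \<le> k"
  shows "length xs \<le> k * num_blocks k xs"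
proof -
  have "length xs + k - 1 = k * num_blocks k xs + (length xs + k - 1) mod k"
    by (simp add: num_blocks_def)
  moreover have "(length xs + k - 1) mod k < k" using assms by simp
  ultimately show ?thesis by linarith
qed

lemma num_blocks_less:
  assumes "1 \<le> k" "i < num_blocks k xs"
  shows "k * i < length xs"
proof -
  have "k * (i + 1) \<le> k * num_blocks k xs" using assms by (intro mult_left_mono) auto
  also have "\<dots> \<le> length xs + k - 1" by (simp add: num_blocks_def)
  finally show ?thesis using assms by simp
qed

lemma nth_block: "j < length (block k xs i) \<Longrightarrow> block k xs i ! j = xs ! (k * i + j)"
  by (auto simp: block_def intro!: nth_drop)

lemma poly_linear_prod_list_0_iff:
  "poly (prod_list (map (\<lambda>a. [:- a, 1:]) xs)) (x :: 'a::field) = 0 \<longleftrightarrow> x \<in> set xs"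
  by (induction xs) auto

lemma block_poly_0_iff: "poly (block_poly k as i) a = 0 \<longleftrightarrow> a \<in> set (block k as i)"
  unfolding block_poly_def by (rule poly_linear_prod_list_0_iff)

lemma degree_linear_prod_list:
  "degree (prod_list (map (\<lambda>a. [:- a, 1:]) xs) :: 'a::field poly) = length xs"
proof (induction xs)
  case (Cons x xs)
  have "prod_list (map (\<lambda>a. [:- a, 1:]) xs) \<noteq> 0" by (auto simp: prod_list_zero_iff)
  then show ?case using Cons by (simp add: degree_mult_eq del: mult_pCons_left)
qed simp

text \<open>The blocks concatenate to the whole list, even if the last one is short. Hence the
  degrees of the T_i add up to the number of points.\<close>

lemma prod_block_poly:
  assumes "1 \<le> k"
  shows "(\<Prod>i<num_blocks k as. block_poly k as i) = prod_list (map (\<lambda>a. [:- a, 1:]) as)"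
proof -
  have "(\<Prod>i<q. block_poly k as i) =
    prod_list (map (\<lambda>a. [:- a, 1:]) (concat (map (block k as) [0..<q])))" for q
    by (induction q) (simp_all add: block_poly_def mult.commute)
  then show ?thesis using num_blocks_cover[OF assms, of as] by (simp add: concat_blocks)
qed

text \<open>The start values are never reduced when the list is empty, so equality with the full
  product is claimed only in the weaker sense needed later: modulo \<open>D\<close> for the first
  component, at the roots of \<open>E\<close> for the second.\<close>

lemma fold_mod_prod:
  fixes T :: "nat \<Rightarrow> 'a::field poly" and D E :: "'a poly"
  defines "f \<equiv> \<lambda>j (U, V). (U * T j mod D, V * T j mod E)"
  shows "fst (fold f xs (u, v)) mod D = u * prod_list (map T xs) mod D \<and>
    (\<forall>a. poly E a = 0 \<longrightarrow> poly (snd (fold f xs (u, v))) a = poly (v * prod_list (map T xs)) a)"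
proof (induction xs arbitrary: u v)
  case Nil
  show ?case by simp
next
  case (Cons x xs)
  have "fst (fold f (x # xs) (u, v)) mod D = (u * T x mod D) * prod_list (map T xs) mod D"
    using Cons.IH[of "u * T x mod D" "v * T x mod E"] by (simp add: f_def)
  also have "\<dots> = u * prod_list (map T (x # xs)) mod D"
    by (simp add: mod_mult_left_eq mult.assoc)
  finally show ?case
    using Cons.IH[of "u * T x mod D" "v * T x mod E"]
    by (simp add: f_def poly_mod_root)
qed

lemma part_interpol_step_sum:
  fixes g ys as :: "'a::field list" and k :: nat
  defines "R \<equiv> \<lambda>i. \<Prod>j\<in>{..<num_blocks k as} - {i}. block_poly k as j"
  defines "b \<equiv> \<lambda>i. map (\<lambda>j. (block k ys i ! j - poly (Poly g) (block k as i ! j)) /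
    (block k as i ! j ^ length g * poly (R i) (block k as i ! j))) [0..<length (block k as i)]"
  shows "part_interpol_step g ys as k i H =
    (H + interpol (block k as i) (b i) * R i) mod monom 1 k"
proof -
  let ?A = "block k as i"
  let ?T = "block_poly k as"
  define xs where "xs = filter (\<lambda>j. j \<noteq> i) [0..<num_blocks k as]"
  define UV where "UV = fold (\<lambda>j (U, V). (U * ?T j mod monom 1 k, V * ?T j mod ?T i)) xs (1, 1)"
  have xs: "prod_list (map ?T xs) = R i"
    unfolding R_def
    by (subst prod.distinct_set_conv_list[symmetric])
      (auto simp: xs_def intro!: prod.cong)
  have U: "fst UV mod monom 1 k = R i mod monom 1 k"
    and V: "\<And>a. poly (?T i) a = 0 \<Longrightarrow> poly (snd UV) a = poly (R i) a"
    using fold_mod_prod[of ?T "monom 1 k" "?T i" xs 1 1] by (auto simp: UV_def xs)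
  have root: "poly (?T i) (?A ! j) = 0" if "j < length ?A" for j
    using that by (simp add: block_poly_0_iff)
  have b': "map (\<lambda>j. (block k ys i ! j - map (poly (Poly g mod ?T i)) ?A ! j) /
      (?A ! j ^ length g * map (poly (snd UV)) ?A ! j)) [0..<length ?A] = b i"
    unfolding b_def by (rule map_cong[OF refl]) (simp add: poly_mod_root[OF root] V[OF root])
  have "part_interpol_step g ys as k i H = (H + interpol ?A (b i) * fst UV) mod monom 1 k"
    unfolding part_interpol_step_def Let_def xs_def[symmetric] UV_def[symmetric]
    by (simp add: case_prod_beta b')
  also have "\<dots> = (H + interpol ?A (b i) * R i) mod monom 1 k"
    by (intro mod_add_cong[OF refl] mod_mult_cong[OF refl] U)
  finally show ?thesis .
qed

text \<open>Solving G(a) + a^s H(a) = y for H(a) and dividing by R_i(a) gives exactly the values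
  that N_i interpolates on block i. Divisibility of the number of points by \<open>k\<close> is not
  assumed, since only the lengths of the actual blocks enter the degree count.\<close>

lemma part_interpol_correct:
  fixes g ys as :: "'a::field list"
  assumes len: "length ys = length as" and k: "1 \<le> k" and dist: "distinct as"
    and nz: "g \<noteq> [] \<Longrightarrow> 0 \<notin> set as"
    and H: "has_size (length as) H"
    and int: "interpolates (Poly g + monom 1 (length g) * H) as ys"
  shows "part_interpol g ys as k = H mod monom 1 k"
proof -
  define nb where "nb = num_blocks k as"
  define A where "A = block k as"
  define T where "T = block_poly k as"
  define R where "R = (\<lambda>i. \<Prod>j\<in>{..<nb} - {i}. T j)"
  define b where "b = (\<lambda>i. map (\<lambda>j. (block k ys i ! j - poly (Poly g) (A i ! j)) /
    (A i ! j ^ length g * poly (R i) (A i ! j))) [0..<length (A i)])"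
  define N where "N = (\<lambda>i. interpol (A i) (b i))"
  define S where "S = (\<Sum>i<nb. N i * R i)"
  have step: "part_interpol_step g ys as k i G = (G + N i * R i) mod monom 1 k" for i G
    unfolding N_def A_def b_def R_def nb_def T_def by (rule part_interpol_step_sum)
  have "fold (part_interpol_step g ys as k) [0..<q] 0 = (\<Sum>i<q. N i * R i) mod monom 1 k" for q
    by (induction q) (simp_all add: step mod_add_left_eq)
  then have PS: "part_interpol g ys as k = S mod monom 1 k"
    by (simp add: part_interpol_def S_def nb_def)
  have distA: "distinct (A i)" for i using dist by (simp add: A_def block_def)
  have N: "has_size (length (A i)) (N i)" "interpolates (N i) (A i) (b i)" for i
    using interpol_correct[OF distA[of i], of "b i"] by (auto simp: N_def b_def)
  have degT: "degree (T i) = length (A i)" for i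
    by (simp add: T_def block_poly_def degree_linear_prod_list A_def)
  have T0: "T i \<noteq> 0" for i
    by (auto simp: T_def block_poly_def prod_list_zero_iff)
  have R0: "R i \<noteq> 0" for i
    by (auto simp: R_def T0)
  \<comment> \<open>deg N_i < deg T_i, so the degree stays below that of T_i R_i, the product over
    all points. If N_i = 0, the degree is 0 and it suffices that the existence of a block forces
    \<open>as\<close> to be nonempty.\<close>
  have deg: "degree (N i * R i) < length as" if i: "i < nb" for i
  proof (cases "N i = 0")
    case True
    then show ?thesis using num_blocks_less[OF k, of i as] i by (auto simp: nb_def)
  next
    case False
    have "T i * R i = (\<Prod>j<nb. T j)"
      unfolding R_def using i by (subst prod.remove[of "{..<nb}" i]) auto
    also have "\<dots> = prod_list (map (\<lambda>a. [:- a, 1:]) as)"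
      unfolding T_def nb_def by (rule prod_block_poly[OF k])
    finally have "degree (T i * R i) = length as" by (simp add: degree_linear_prod_list)
    then show ?thesis using False N(1)[of i] R0 T0 degT[of i]
      by (auto simp: degree_mult_eq has_size_def)
  qed
  have S: "has_size (length as) S"
  proof (cases "as = []")
    case True
    then have "nb = 0" using num_blocks_less[OF k, of 0 as] by (auto simp: nb_def)
    then show ?thesis by (simp add: S_def has_size_def)
  next
    case False
    then show ?thesis using deg unfolding has_size_def S_def
      by (intro disjI2 degree_sum_less) auto
  qed
  have "poly S a = poly H a" if a: "a \<in> set as" for a
  proof -
    obtain q where q: "q < length as" "a = as ! q" using a by (auto simp: in_set_conv_nth)
    \<comment> \<open>Division with remainder locates the point: it is entry \<open>j\<close> of
      block \<open>i\<close>.\<close>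
    define i where "i = q div k"
    define j where "j = q mod k"
    have ij: "q = k * i + j" "j < k" using k by (auto simp: i_def j_def)
    have j: "j < length (A i)" using ij q(1) by (auto simp: A_def block_def)
    have Aij: "A i ! j = a" using j by (simp add: A_def nth_block ij q)
    have Yij: "block k ys i ! j = ys ! q"
      using j len by (subst nth_block) (auto simp: A_def block_def ij)
    have aA: "a \<in> set (A i)" using j Aij nth_mem by metis
    have "k * i < k * nb" using ij(1) q(1) num_blocks_cover[OF k, of as] unfolding nb_def by linarith
    then have i: "i < nb" by simp
    have other: "a \<notin> set (A i')" if "i' \<noteq> i" for i'
    proof
      assume "a \<in> set (A i')"
      then obtain j' where j': "j' < length (A i')" "A i' ! j' = a" by (auto simp: in_set_conv_nth)
      then have "as ! (k * i' + j') = as ! q" by (simp add: A_def nth_block q)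
      moreover have "k * i' + j' < length as" using j'(1) by (auto simp: A_def block_def)
      ultimately have "q = k * i' + j'" using dist q(1) by (simp add: nth_eq_iff_index_eq)
      moreover have "j' < k" using j'(1) by (simp add: A_def block_def)
      ultimately have "i = i'" by (simp add: i_def)
      then show False using that by simp
    qed
    have Ria: "poly (R i) a \<noteq> 0"
      using other by (auto simp: R_def poly_prod T_def block_poly_0_iff A_def)
    \<comment> \<open>R_i' contains the factor T_i, which vanishes at \<open>a\<close>; hence a
      single summand of \<open>S\<close> survives at \<open>a\<close>.\<close>
    have Rother: "poly (R i') a = 0" if "i' \<noteq> i" for i'
      using i that aA by (auto simp: R_def poly_prod T_def block_poly_0_iff A_def)
    \<comment> \<open>If \<open>g\<close> is empty the exponent is 0 and the power is 1, even at a =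
      0.\<close>
    have apow: "a ^ length g \<noteq> 0" using nz a by auto
    have "poly S a = (\<Sum>i'<nb. poly (N i') a * poly (R i') a)" by (simp add: S_def poly_sum)
    also have "\<dots> = poly (N i) a * poly (R i) a"
      using i Rother by (subst sum.remove[of _ i]) auto
    also have "poly (N i) a = b i ! j"
      using N(2)[of i] j Aij by (auto simp: interpolates_def)
    also have "b i ! j = (ys ! q - poly (Poly g) a) / (a ^ length g * poly (R i) a)"
      using j by (simp add: b_def Aij Yij)
    also have "ys ! q = poly (Poly g + monom 1 (length g) * H) a"
      using int q by (simp add: interpolates_def)
    finally show ?thesis using Ria apow by (auto simp: poly_monom)
  qed
  then have "S = H" using interpolates_unique[OF dist S H] by blast
  then show ?thesis using PS by simp
qed

text \<open>This brings F into the form G + X^s H, with G = F mod X^s and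
  \<open>poly_shift s F\<close> the quotient of F by X^s.\<close>

lemma poly_split_at:
  "F = Poly (map (coeff F) [0..<s]) + monom 1 s * poly_shift s (F :: 'a::comm_semiring_1 poly)"
  by (rule poly_eqI) (auto simp: coeff_monom_mult coeff_poly_shift nth_default_def)

lemma has_size_iff_coeff: "has_size n p \<longleftrightarrow> (\<forall>i\<ge>n. coeff p i = 0)"
proof
  show "has_size n p \<Longrightarrow> \<forall>i\<ge>n. coeff p i = 0"
    by (auto simp: has_size_def intro: coeff_eq_0)
  show "\<forall>i\<ge>n. coeff p i = 0 \<Longrightarrow> has_size n p"
    by (metis has_size_def leading_coeff_neq_0 not_le)
qed

lemma has_size_poly_shift: "has_size n F \<Longrightarrow> has_size (n - s) (poly_shift s F)"
  by (auto simp: has_size_iff_coeff coeff_poly_shift)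

text \<open>The quotient H of F by X^s has size n - s, and the first n - s points impose just as
  many conditions on it. So they determine H, whose low coefficients are the next ones of F.\<close>

lemma part_interpol_chunk:
  fixes as ys :: "'a::field list" and F :: "'a poly"
  assumes "length as = n" "distinct as" "1 \<le> k" "j < k"
    and nz: "s \<noteq> 0 \<Longrightarrow> \<forall>i<n - s. as ! i \<noteq> 0"
    and F: "has_size n F" "interpolates F as ys"
  shows "coeff (part_interpol (map (coeff F) [0..<s]) (take (n - s) ys) (take (n - s) as) k) j =
    coeff F (s + j)"
proof -
  have "part_interpol (map (coeff F) [0..<s]) (take (n - s) ys) (take (n - s) as) k =
      poly_shift s F mod monom 1 k"
  proof (rule part_interpol_correct)
    show "length (take (n - s) ys) = length (take (n - s) as)"
      using F(2) by (simp add: interpolates_def)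
    show "0 \<notin> set (take (n - s) as)" if "map (coeff F) [0..<s] \<noteq> []"
      using nz that assms(1) by (auto simp: in_set_conv_nth)
    show "has_size (length (take (n - s) as)) (poly_shift s F)"
      using has_size_poly_shift[OF F(1)] assms(1) by simp
    show "interpolates (Poly (map (coeff F) [0..<s]) +
        monom 1 (length (map (coeff F) [0..<s])) * poly_shift s F) (take (n - s) as) (take (n - s) ys)"
      using F(2) assms(1) by (simp add: poly_split_at[symmetric] interpolates_def)
  qed (use assms in auto)
  then show ?thesis using \<open>j < k\<close> by (simp add: coeff_mod_monom coeff_poly_shift add.commute)
qed

section \<open>Chunk sizes, placement of the work space, and the loop invariant\<close>

section \<open>The main loop\<close>

text \<open>Everything follows from rounding x = m / (1 + c_pi) down to k: k \<le> x leaves room for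
  the work space, and x \<le> k + 1 bounds the ratio m / k. The summand 1 / k is the price of
  rounding.\<close>

lemma chunk_size_bounds:
  assumes "0 < m" "0 \<le> c_pi"
  defines "k \<equiv> chunk_size c_pi m"
  shows "1 \<le> k" "k \<le> m" "real m / real k \<le> (1 + c_pi) * (1 + 1 / real k)"
    "nat \<lfloor>c_pi * real k\<rfloor> \<le> m - k \<or> nat \<lfloor>c_pi * real k\<rfloor> \<le> nat \<lfloor>c_pi * (c_pi + 1)\<rfloor>"
proof -
  define x where "x = real m / (c_pi + 1)"
  have x: "x \<ge> 0" "x * (c_pi + 1) = real m" using assms by (auto simp: x_def)
  have "1 \<le> k \<and> k \<le> m \<and> real m / real k \<le> (1 + c_pi) * (1 + 1 / real k) \<and>
    (nat \<lfloor>c_pi * real k\<rfloor> \<le> m - k \<or> nat \<lfloor>c_pi * real k\<rfloor> \<le> nat \<lfloor>c_pi * (c_pi + 1)\<rfloor>)"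
  proof (cases "nat \<lfloor>x\<rfloor> = 0")
    \<comment> \<open>Here x < 1: the few remaining coefficients form one last chunk, with ratio m /
      k = 1.\<close>
    case True
    then have k: "k = m" by (simp add: k_def chunk_size_def x_def)
    have "x < 1" using True by linarith
    then have "real m \<le> c_pi + 1" using x assms(2) mult_right_mono[of x 1 "c_pi + 1"] by simp
    then have "c_pi * real m \<le> c_pi * (c_pi + 1)" using assms(2) by (intro mult_left_mono)
    then have "nat \<lfloor>c_pi * real k\<rfloor> \<le> nat \<lfloor>c_pi * (c_pi + 1)\<rfloor>"
      unfolding k by (intro nat_mono floor_mono)
    moreover have "1 * 1 \<le> (1 + c_pi) * (1 + 1 / real m)"
      using assms(2) by (intro mult_mono) auto
    ultimately show ?thesis using k assms(1) by auto
  next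
    case False
    then have k_floor: "k = nat \<lfloor>x\<rfloor>"
      unfolding k_def chunk_size_def Let_def x_def[symmetric] by simp
    with False have k1: "1 \<le> k" by linarith
    have kx: "real k \<le> x" "x \<le> real k + 1" using k_floor x by linarith+
    have "real k * (c_pi + 1) \<le> real m"
      using kx assms(2) mult_right_mono[of "real k" x "c_pi + 1"] x by simp
    then have km: "c_pi * real k \<le> real m - real k" by (simp add: algebra_simps)
    moreover have "0 \<le> c_pi * real k" using assms(2) by simp
    ultimately have "k \<le> m" by linarith
    then have "nat \<lfloor>c_pi * real k\<rfloor> \<le> m - k" using km by linarith
    moreover have "real m \<le> (real k + 1) * (c_pi + 1)"
      using kx assms(2) mult_right_mono[of x "real k + 1" "c_pi + 1"] x by simp
    then have "real m / real k \<le> (real k + 1) * (c_pi + 1) / real k"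
      using k1 by (intro divide_right_mono) auto
    moreover have "(real k + 1) * (c_pi + 1) / real k = (1 + c_pi) * (1 + 1 / real k)"
      using k1 by (simp add: field_simps)
    ultimately show ?thesis using k1 \<open>k \<le> m\<close> by simp
  qed
  then show "1 \<le> k" "k \<le> m" "real m / real k \<le> (1 + c_pi) * (1 + 1 / real k)"
    "nat \<lfloor>c_pi * real k\<rfloor> \<le> m - k \<or> nat \<lfloor>c_pi * real k\<rfloor> \<le> nat \<lfloor>c_pi * (c_pi + 1)\<rfloor>"
    by auto
qed

lemma length_work_space: "length (work_space c_pi n s k) = nat \<lfloor>c_pi * real k\<rfloor>"
  unfolding work_space_def Let_def length_take length_append length_map length_upt by arith

lemma distinct_work_space: "distinct (work_space c_pi n s k)"
  unfolding work_space_def Let_def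
  by (intro distinct_take) (auto simp: distinct_map inj_on_def)

text \<open>This makes the extra space O(1): the range of \<open>Ext\<close> indices depends on
  \<open>c_pi\<close> alone. It starts at 2 because \<open>Ext 0\<close> and \<open>Ext 1\<close>
  hold s and k.\<close>

lemma set_work_space:
  assumes "s < n" "0 \<le> c_pi" "k = chunk_size c_pi (n - s)"
  shows "set (work_space c_pi n s k) \<subseteq>
    Out ` {s + k..<n} \<union> Ext ` {2..<2 + nat \<lfloor>c_pi * (c_pi + 1)\<rfloor>}"
proof -
  define w where "w = nat \<lfloor>c_pi * real k\<rfloor>"
  have "w \<le> (n - s) - k \<or> w \<le> nat \<lfloor>c_pi * (c_pi + 1)\<rfloor>"
    using chunk_size_bounds(4)[of "n - s" c_pi] assms by (simp add: w_def)
  then show ?thesis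
  proof
    assume "w \<le> (n - s) - k"
    then have "set (work_space c_pi n s k) \<subseteq> set (map Out [s + k..<n])"
      by (auto simp: work_space_def w_def[symmetric] Let_def simp del: set_map set_upt dest: in_set_takeD)
    then show ?thesis by auto
  next
    assume "w \<le> nat \<lfloor>c_pi * (c_pi + 1)\<rfloor>"
    moreover have "set (work_space c_pi n s k) \<subseteq> set (map Out [s + k..<n] @ map Ext [2..<2 + w])"
      unfolding work_space_def w_def[symmetric] Let_def by (rule set_take_subset)
    ultimately show ?thesis by fastforce
  qed
qed

text \<open>\<open>Q\<close> is a budget of operations per output coefficient, and
  \<open>\<sigma>\<close> is the initial memory. The lower bound on a nonzero s records that the
  first chunk is complete, which limits the points that later calls read.\<close>

definition loop_invariant :: "real \<Rightarrow> nat \<Rightarrow> 'a::field poly \<Rightarrow> 'a mem \<Rightarrow> real \<Rightarrow> 'a state \<Rightarrow> bool" where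
  "loop_invariant c_pi n F \<sigma> Q st \<longleftrightarrow>
     (\<exists>s. memory st (Ext 0) = Ptr s \<and> s \<le> n \<and> (s \<noteq> 0 \<longrightarrow> chunk_size c_pi n \<le> s) \<and>
        (\<forall>j<s. memory st (Out j) = Elem (coeff F j)) \<and>
        (\<forall>j. memory st (Inp j) = \<sigma> (Inp j)) \<and>
        extra_regs st \<subseteq> {..<2 + nat \<lfloor>c_pi * (c_pi + 1)\<rfloor>} \<and>
        real (ops st) \<le> real s * Q)"

text \<open>The cost of the subroutine enters only through an abstract bound \<open>t\<close> that
  charges at most \<open>Q\<close> to each coefficient of the new chunk, so memory reasoning and
  cost estimate stay separate. The increase of s serves termination.\<close>

lemma in_place_interpol_body_invariant:
  fixes as ys :: "'a::field list" and P :: "'a part_interpol_sub"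
  assumes inv: "loop_invariant c_pi n F \<sigma> Q st" and less: "get_ptr 0 st < n"
    and c_pi: "0 \<le> c_pi"
    and input: "holds_input n ys as \<sigma>" "distinct as" "\<forall>i < n - chunk_size c_pi n. as ! i \<noteq> 0"
    and F: "has_size n F" "interpolates F as ys"
    and P: "implements_part_interpol c_pi P"
    and P_time: "\<And>gl yl al ol wl \<sigma> g ys as k. part_interpol_call c_pi gl yl al ol wl \<sigma> g ys as k \<Longrightarrow>
      real (snd (P gl yl al ol wl \<sigma>)) \<le> t (length g) (length as) k"
    and t: "\<And>s. s < n \<Longrightarrow> t s (n - s) (chunk_size c_pi (n - s)) \<le> real (chunk_size c_pi (n - s)) * Q"
  defines "st' \<equiv> in_place_interpol_body c_pi P n st"
  shows "loop_invariant c_pi n F \<sigma> Q st'" "get_ptr 0 st < get_ptr 0 st'"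
proof -
  obtain s where s: "memory st (Ext 0) = Ptr s" "s \<noteq> 0 \<longrightarrow> chunk_size c_pi n \<le> s"
    and out: "\<And>j. j < s \<Longrightarrow> memory st (Out j) = Elem (coeff F j)"
    and inp: "\<And>j. memory st (Inp j) = \<sigma> (Inp j)"
    and regs: "extra_regs st \<subseteq> {..<2 + nat \<lfloor>c_pi * (c_pi + 1)\<rfloor>}"
    and ops: "real (ops st) \<le> real s * Q"
    using inv by (auto simp: loop_invariant_def)
  have sn: "s < n" using less s by (simp add: get_ptr_def)
  define k where "k = chunk_size c_pi (n - s)"
  have k: "1 \<le> k" "k \<le> n - s"
    using chunk_size_bounds(1,2)[of "n - s" c_pi] sn c_pi by (auto simp: k_def)
  define \<sigma>1 where "\<sigma>1 = (memory st)(Ext 1 := Ptr k)"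
  define wl where "wl = work_space c_pi n s k"
  define ol where "ol = map Out [s..<s + k]"
  define gl where "gl = map Out [0..<s]"
  define yl where "yl = map Inp [0..<n - s]"
  define al where "al = map Inp [n..<n + (n - s)]"
  have wl: "set wl \<subseteq> Out ` {s + k..<n} \<union> Ext ` {2..<2 + nat \<lfloor>c_pi * (c_pi + 1)\<rfloor>}"
    unfolding wl_def using sn c_pi k_def by (rule set_work_space)
  have len: "length as = n" "length ys = n" using input(1) by (auto simp: holds_input_def)
  \<comment> \<open>Once s > 0, it is at least the size of the first chunk, so the points still read
    lie in the range where 0 is excluded.\<close>
  have nz: "as ! i \<noteq> 0" if "s \<noteq> 0" "i < n - s" for i
    using input(3) s(2) that by (metis diff_le_mono2 order_less_le_trans)
  \<comment> \<open>The call is free of aliasing: G, the result and the borrowed output registers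
    occupy the index ranges [0, s), [s, s + k) and [s + k, n).\<close>
  have call: "part_interpol_call c_pi gl yl al ol wl \<sigma>1 (map (coeff F) [0..<s])
      (take (n - s) ys) (take (n - s) as) k"
    unfolding part_interpol_call_def
  proof (intro conjI)
    show "map \<sigma>1 gl = map Elem (map (coeff F) [0..<s])"
      using out by (simp add: gl_def \<sigma>1_def)
    show "map \<sigma>1 yl = map Elem (take (n - s) ys)"
      using input(1) by (intro nth_equalityI) (auto simp: yl_def \<sigma>1_def inp holds_input_def)
    show "map \<sigma>1 al = map Elem (take (n - s) as)"
      using input(1) by (intro nth_equalityI) (auto simp: al_def \<sigma>1_def inp holds_input_def)
    show "length wl = nat \<lfloor>c_pi * real k\<rfloor>" by (simp add: wl_def length_work_space)
    show "distinct (ol @ wl)"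
      using wl distinct_work_space[of c_pi n s k] by (auto simp: ol_def distinct_map inj_on_def wl_def)
    show "set (ol @ wl) \<inter> set (gl @ yl @ al) = {}" "set (ol @ wl) \<inter> range Inp = {}"
      using wl by (auto simp: ol_def gl_def yl_def al_def)
    show "map (coeff F) [0..<s] \<noteq> [] \<longrightarrow> 0 \<notin> set (take (n - s) as)"
      using nz len by (auto simp: in_set_conv_nth)
  qed (use k len input(2) in \<open>auto simp: ol_def\<close>)
  define \<sigma>' where "\<sigma>' = fst (P gl yl al ol wl \<sigma>1)"
  have res: "map \<sigma>' ol = map (\<lambda>j. Elem (coeff F (s + j))) [0..<k]"
    and frame: "\<And>l. l \<notin> set (ol @ wl) \<Longrightarrow> \<sigma>' l = \<sigma>1 l"
    using P[unfolded implements_part_interpol_def, rule_format, OF call]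
      part_interpol_chunk[OF len(1) input(2) k(1) _ _ F] nz
    by (auto simp: \<sigma>'_def Let_def)
  have st': "memory st' = \<sigma>'(Ext 0 := Ptr (s + k))"
    "ops st' = ops st + snd (P gl yl al ol wl \<sigma>1)"
    "extra_regs st' = insert 0 (insert 1 (extra_regs st) \<union> {j. Ext j \<in> set wl})"
    using s(1)
    by (simp_all add: st'_def in_place_interpol_body_def Let_def get_ptr_def put_ptr_def call_sub_def
        k_def[symmetric] gl_def[symmetric] yl_def[symmetric] al_def[symmetric] ol_def[symmetric]
        wl_def[symmetric] \<sigma>1_def \<sigma>'_def case_prod_beta)
  show "get_ptr 0 st < get_ptr 0 st'" using k s(1) by (simp add: get_ptr_def st')
  \<comment> \<open>Below s the frame condition preserves the old coefficients; from s on they come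
    from the result of the call.\<close>
  have "\<sigma>' (Out j) = Elem (coeff F j)" if "j < s + k" for j
  proof (cases "j < s")
    case True
    then show ?thesis using wl out by (subst frame) (auto simp: ol_def \<sigma>1_def)
  next
    case False
    then show ?thesis using arg_cong[OF res, of "\<lambda>xs. xs ! (j - s)"] that by (simp add: ol_def)
  qed
  moreover have "\<sigma>' (Inp j) = \<sigma> (Inp j)" for j
    using wl inp by (subst frame) (auto simp: ol_def \<sigma>1_def)
  moreover have "extra_regs st' \<subseteq> {..<2 + nat \<lfloor>c_pi * (c_pi + 1)\<rfloor>}"
    using wl regs by (auto simp: st')
  moreover have "real (ops st') \<le> real (s + k) * Q"
  proof -
    have "real (snd (P gl yl al ol wl \<sigma>1)) \<le> t s (n - s) k"
      using P_time[OF call] len by simp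
    also have "\<dots> \<le> real k * Q" using t[OF sn] by (simp add: k_def)
    finally show ?thesis using ops by (simp add: st' algebra_simps)
  qed
  \<comment> \<open>In the first iteration, s = 0 and k is itself the first chunk size.\<close>
  moreover have "chunk_size c_pi n \<le> s + k" using s(2) by (cases "s = 0") (auto simp: k_def)
  ultimately show "loop_invariant c_pi n F \<sigma> Q st'"
    using k sn by (auto simp: loop_invariant_def st')
qed

section \<open>Cost of one chunk charged to its coefficients, and the total\<close>

section \<open>The operation count\<close>

text \<open>Origin of the constants: 3/2 c^2 + 23/2 c is the excess of the leading factor caused by
  r exceeding c; 4 c^2 |C| comes from r \<le> 2 c in the error term; 2 c log n comes from m = r k
  \<le> 2 c k together with s \<le> n.\<close>

lemma chunk_cost_le:
  fixes M :: "nat \<Rightarrow> real" and c C :: real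
  assumes M: "\<And>n. 0 \<le> M n"
    "\<And>\<alpha> n m. \<alpha> \<ge> 1 \<Longrightarrow> n \<ge> 1 \<Longrightarrow> real m = \<alpha> * real n \<Longrightarrow> \<alpha> * M n \<le> M m"
    and c: "1 \<le> c" and k: "1 \<le> k" "k \<le> n" "s \<le> n"
    and r: "0 \<le> r" "m = r * real k" "r \<le> c * (1 + 1 / real k)"
  defines "L \<equiv> \<lambda>x. max 1 (log 2 (log 2 (real x)))"
  shows "(1/2 * r^2 + 23/2 * r) * M k * log 2 (real k) + m * log 2 (real s) + C * (r^2 * M k * L k)
    \<le> real k * ((1/2 * (c^2 + 23 * c) * log 2 (real n) + (3/2 * c^2 + 23/2 * c + 4 * c^2 * \<bar>C\<bar>) * L n)
        * (M n / real n) + 2 * c * log 2 (real n))"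
proof -
  define \<mu> where "\<mu> = M n / real n"
  have n: "1 \<le> n" using k by simp
  have \<mu>: "0 \<le> \<mu>" using M(1) by (simp add: \<mu>_def)
  \<comment> \<open>Superlinearity with factor n / k.\<close>
  have Mk: "M k \<le> real k * \<mu>"
    using M(2)[of "real n / real k" k n] k by (simp add: \<mu>_def field_simps)
  have c0: "0 \<le> c" using c by simp
  have inv: "0 < 1 / real k" "1 / real k \<le> 1" using k by auto
  have r2c: "r \<le> 2 * c" using r(3) mult_left_mono[of "1 + 1 / real k" 2 c] c0 inv by linarith
  have L: "1 \<le> L k" "L k \<le> L n"
  proof -
    show "1 \<le> L k" by (simp add: L_def)
    show "L k \<le> L n"
    proof (cases "k = 1")
      case False
      then have "0 < log 2 (real k)" "log 2 (real k) \<le> log 2 (real n)" using k by auto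
      then have "log 2 (log 2 (real k)) \<le> log 2 (log 2 (real n))" by simp
      then show ?thesis by (simp add: L_def)
    \<comment> \<open>For k = 1 the inner logarithm is 0, and log 0 = 0 by convention, so
      \<open>L k\<close> is 1.\<close>
    qed (simp add: L_def log_def)
  qed
  have l: "0 \<le> log 2 (real k)" "log 2 (real k) \<le> log 2 (real n)" "log 2 (real k) \<le> real k"
    using k log2_of_power_less[OF less_exp[of k]] by auto
  have "r^2 \<le> (c * (1 + 1 / real k))^2" using r by (intro power_mono)
  also have "\<dots> = c^2 * (1 + 2 * (1 / real k) + (1 / real k) * (1 / real k))"
    by (simp add: power2_eq_square algebra_simps)
  \<comment> \<open>1 / k^2 \<le> 1 / k merges the quadratic term into the linear one.\<close>
  also have "\<dots> \<le> c^2 * (1 + 3 / real k)"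
    using inv mult_right_mono[of "1 / real k" 1 "1 / real k"] by (intro mult_left_mono) auto
  finally have r2: "r^2 \<le> c^2 * (1 + 3 / real k)" .
  have "1/2 * r^2 + 23/2 * r \<le> 1/2 * (c^2 * (1 + 3 / real k)) + 23/2 * (c * (1 + 1 / real k))"
    by (intro add_mono mult_left_mono r2 r(3)) auto
  also have "\<dots> = 1/2 * (c^2 + 23 * c) + (3/2 * c^2 + 23/2 * c) / real k"
    using k by (simp add: field_simps)
  finally have "(1/2 * r^2 + 23/2 * r) * log 2 (real k) \<le>
      (1/2 * (c^2 + 23 * c) + (3/2 * c^2 + 23/2 * c) / real k) * log 2 (real k)"
    using l(1) by (rule mult_right_mono)
  also have "\<dots> = 1/2 * (c^2 + 23 * c) * log 2 (real k) + (3/2 * c^2 + 23/2 * c) * (log 2 (real k) / real k)"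
    by (simp only: distrib_right times_divide_eq_right times_divide_eq_left)
  also have "\<dots> \<le> 1/2 * (c^2 + 23 * c) * log 2 (real n) + (3/2 * c^2 + 23/2 * c) * L n"
  proof -
    \<comment> \<open>The quotient is at most 1 and \<open>L n\<close> is at least 1; this moves the
      rounding excess into the log log term.\<close>
    have "log 2 (real k) / real k \<le> L n" using l(3) L k
      by (simp add: divide_le_eq)
        (smt (verit) mult_right_mono mult_le_cancel_right1 of_nat_0_le_iff)
    then show ?thesis using l(2) c0 by (intro add_mono mult_left_mono) auto
  qed
  finally have a: "(1/2 * r^2 + 23/2 * r) * log 2 (real k) \<le>
      1/2 * (c^2 + 23 * c) * log 2 (real n) + (3/2 * c^2 + 23/2 * c) * L n" .
  have "C * (r^2 * L k) \<le> \<bar>C\<bar> * (r^2 * L k)"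
    using L by (intro mult_right_mono) auto
  also have "\<dots> \<le> \<bar>C\<bar> * ((2 * c)^2 * L n)"
    using L r(1) r2c by (intro mult_left_mono mult_mono power_mono) auto
  finally have b: "C * (r^2 * L k) \<le> 4 * c^2 * \<bar>C\<bar> * L n" by (simp add: power_mult_distrib mult_ac)
  let ?X = "1/2 * (c^2 + 23 * c) * log 2 (real n) + (3/2 * c^2 + 23/2 * c + 4 * c^2 * \<bar>C\<bar>) * L n"
  have X: "(1/2 * r^2 + 23/2 * r) * log 2 (real k) + C * (r^2 * L k) \<le> ?X"
    using a b by (simp add: algebra_simps)
  \<comment> \<open>The sign is needed to replace \<open>M k\<close> by its upper bound
    below.\<close>
  have X0: "0 \<le> ?X" using c0 n L by (intro add_nonneg_nonneg mult_nonneg_nonneg) auto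
  have "((1/2 * r^2 + 23/2 * r) * log 2 (real k) + C * (r^2 * L k)) * M k \<le> ?X * M k"
    using X M(1) by (rule mult_right_mono)
  also have "\<dots> \<le> ?X * (real k * \<mu>)" using Mk X0 by (rule mult_left_mono)
  finally have main: "((1/2 * r^2 + 23/2 * r) * log 2 (real k) + C * (r^2 * L k)) * M k \<le> ?X * (real k * \<mu>)" .
  have "log 2 (real s) \<le> log 2 (real n)"
  proof (cases "s = 0")
    \<comment> \<open>In the first call the term m log s has s = 0 and vanishes by the convention
      log 0 = 0.\<close>
    case True
    then show ?thesis using n by (simp add: log_def)
  next
    case False
    then show ?thesis using k by simp
  qed
  then have "m * log 2 (real s) \<le> (2 * c * real k) * log 2 (real n)"
    unfolding r(2) using r(1) r2c n c0
    by (intro order_trans[OF mult_left_mono mult_right_mono[OF mult_right_mono]]) auto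
  with main show ?thesis unfolding \<mu>_def[symmetric] by (simp add: algebra_simps)
qed

text \<open>The condition on zero points concerns those that calls with s > 0 can read: at 0 the
  value of G + X^s H does not depend on H.\<close>

theorem theorem3p6:
  fixes P :: "'a::field part_interpol_sub"
    and M :: "nat \<Rightarrow> real"
    and c_pi c :: real
  assumes M_nonneg: "\<And>n. 0 \<le> M n"
    and M_superlinear: "\<And>\<alpha> n m. \<alpha> \<ge> 1 \<Longrightarrow> n \<ge> 1 \<Longrightarrow> real m = \<alpha> * real n \<Longrightarrow> \<alpha> * M n \<le> M m"
    and M_not_too_small: "(\<lambda>n. real n * log 2 (real n)) \<in> O(\<lambda>n. M n * log 2 (log 2 (real n)))"
    and c_pi_nonneg: "c_pi \<ge> 0"
    and c_def: "c = 1 + c_pi"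
    and P_correct: "implements_part_interpol c_pi P"
    and P_time: "part_interpol_time c_pi M P"
  shows "\<exists>B. \<exists>e \<in> O(\<lambda>n. M n * log 2 (log 2 (real n))).
           \<forall>n ys as \<sigma>. holds_input n ys as \<sigma> \<and> distinct as \<and>
               (\<forall>i < n - chunk_size c_pi n. as ! i \<noteq> 0) \<longrightarrow>
             (\<exists>st F. in_place_interpol c_pi P n \<sigma> = Some st \<and>
                has_size n F \<and> interpolates F as ys \<and>
                (\<forall>F'. has_size n F' \<and> interpolates F' as ys \<longrightarrow> F' = F) \<and>
                holds_output n F (memory st) \<and>
                (\<forall>j. memory st (Inp j) = \<sigma> (Inp j)) \<and>
                finite (extra_regs st) \<and> card (extra_regs st) \<le> B \<and>
                real (ops st) \<le> 1/2 * (c^2 + 23 * c) * M n * log 2 (real n) + e n)"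
proof -
  have c: "1 \<le> c" using c_pi_nonneg c_def by simp
  obtain C where C: "\<And>gl yl al ol wl \<sigma> g ys as k. part_interpol_call c_pi gl yl al ol wl \<sigma> g ys as k \<Longrightarrow>
      real (snd (P gl yl al ol wl \<sigma>)) \<le>
        (1/2 * (real (length as) / real k)^2 + 23/2 * (real (length as) / real k)) * M k * log 2 (real k)
        + real (length as) * log 2 (real (length g))
        + C * ((real (length as) / real k)^2 * M k * max 1 (log 2 (log 2 (real k))))"
    using P_time unfolding part_interpol_time_def Let_def by blast
  define t where "t = (\<lambda>s m k. (1/2 * (real m / real k)^2 + 23/2 * (real m / real k)) * M k * log 2 (real k)
    + real m * log 2 (real s) + C * ((real m / real k)^2 * M k * max 1 (log 2 (log 2 (real k)))))"
  define L where "L = (\<lambda>n :: nat. max 1 (log 2 (log 2 (real n))))"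
  define K where "K = 3/2 * c^2 + 23/2 * c + 4 * c^2 * \<bar>C\<bar>"
  \<comment> \<open>Q and e are matched so that for n > 0 the total budget n Q(n) is exactly the
    leading term plus e(n).\<close>
  define Q where "Q = (\<lambda>n. (1/2 * (c^2 + 23 * c) * log 2 (real n) + K * L n) * (M n / real n)
    + 2 * c * log 2 (real n))"
  define e where "e = (\<lambda>n. K * (M n * L n) + 2 * c * (real n * log 2 (real n)))"
  define B where "B = 2 + nat \<lfloor>c_pi * (c_pi + 1)\<rfloor>"
  have K: "0 \<le> K" using c by (simp add: K_def)
  have t: "t s (n - s) (chunk_size c_pi (n - s)) \<le> real (chunk_size c_pi (n - s)) * Q n" if "s < n" for s n
  proof -
    have k: "1 \<le> chunk_size c_pi (n - s)" "chunk_size c_pi (n - s) \<le> n - s"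
      "real (n - s) / real (chunk_size c_pi (n - s)) \<le> c * (1 + 1 / real (chunk_size c_pi (n - s)))"
      using chunk_size_bounds(1-3)[of "n - s" c_pi] that c_pi_nonneg c_def by auto
    show ?thesis
      unfolding t_def Q_def K_def L_def
      by (rule chunk_cost_le[OF M_nonneg M_superlinear c]) (use k that in auto)
  qed
  have e: "e \<in> O(\<lambda>n. M n * log 2 (log 2 (real n)))"
  proof -
    \<comment> \<open>From n = 4 on, log log n is at least 1 and the maximum has no effect.\<close>
    have "\<forall>\<^sub>F n in sequentially. L n = log 2 (log 2 (real n))"
      using eventually_ge_at_top[of 4]
    proof eventually_elim
      case (elim n)
      have "log 2 4 = (2 :: real)" using log_pow_cancel[of 2 2] by simp
      moreover have "log 2 4 \<le> log 2 (real n)" using elim by simp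
      ultimately have "log 2 2 \<le> log 2 (log 2 (real n))" by (subst log_le_cancel_iff) auto
      then show ?case by (simp add: L_def)
    qed
    then have "(\<lambda>n. M n * L n) \<in> O(\<lambda>n. M n * log 2 (log 2 (real n)))"
      by (intro bigoI[of _ 1]) (auto elim!: eventually_mono)
    \<comment> \<open>The n log n part, accumulated from the (n - s) log s terms, is absorbed by the
      lower growth assumption on \<open>M\<close>.\<close>
    then show ?thesis unfolding e_def
      using M_not_too_small by (intro sum_in_bigo) auto
  qed
  show ?thesis
  proof (intro exI[of _ B] bexI[OF _ e] allI impI, elim conjE)
    fix n ys as and \<sigma> :: "'a mem"
    assume input: "holds_input n ys as \<sigma>" and dist: "distinct as"
      and nz: "\<forall>i < n - chunk_size c_pi n. as ! i \<noteq> 0"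
    have len: "length as = n" "length ys = n" using input by (auto simp: holds_input_def)
    obtain F where F: "has_size n F" "interpolates F as ys"
      using interpolates_exists[OF dist, of ys] len by auto
    have unique: "F' = F" if "has_size n F'" "interpolates F' as ys" for F'
      using interpolates_unique_list[OF dist _ _ that(2) F(2)] that(1) F(1) len by simp
    let ?I = "loop_invariant c_pi n F \<sigma> (Q n)"
    have body: "?I (in_place_interpol_body c_pi P n st) \<and>
        n - get_ptr 0 (in_place_interpol_body c_pi P n st) < n - get_ptr 0 st"
      if st: "?I st" "get_ptr 0 st < n" for st
      using in_place_interpol_body_invariant[OF st c_pi_nonneg input dist nz F P_correct, of t]
        t C st(2) by (auto simp: t_def intro!: diff_less_mono2)
    have init: "?I (put_ptr 0 0 \<lparr>memory = \<sigma>, ops = 0, extra_regs = {}\<rparr>)"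
      by (simp add: loop_invariant_def put_ptr_def)
    \<comment> \<open>Termination: n - s strictly decreases along the loop.\<close>
    have "\<exists>st. in_place_interpol c_pi P n \<sigma> = Some st"
      unfolding in_place_interpol_def
      by (rule measure_while_option_Some[where P = ?I and f = "\<lambda>st. n - get_ptr 0 st"])
        (use body init in blast)+
    then obtain st where run: "in_place_interpol c_pi P n \<sigma> = Some st" ..
    have "?I st"
      using while_option_rule[where P = ?I, OF _ run[unfolded in_place_interpol_def] init] body by blast
    moreover have "\<not> get_ptr 0 st < n"
      using while_option_stop[OF run[unfolded in_place_interpol_def]] .
    ultimately have st: "in_place_interpol c_pi P n \<sigma> = Some st"
        "holds_output n F (memory st)" "\<forall>j. memory st (Inp j) = \<sigma> (Inp j)"
        "extra_regs st \<subseteq> {..<B}" "real (ops st) \<le> real n * Q n"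
      using run by (auto simp: loop_invariant_def get_ptr_def holds_output_def B_def)
    have regs: "finite (extra_regs st)" "card (extra_regs st) \<le> B"
      using finite_subset[OF st(4)] card_mono[OF _ st(4)] by simp_all
    have "real n * Q n \<le> 1/2 * (c^2 + 23 * c) * M n * log 2 (real n) + e n"
    proof (cases "n = 0")
      \<comment> \<open>For n = 0 the left side is 0, the leading term vanishes since log 0 = 0, and
        \<open>e 0\<close> is nonnegative.\<close>
      case True
      then show ?thesis using K M_nonneg[of 0] by (simp add: e_def log_def L_def)
    next
      case False
      then show ?thesis by (simp add: Q_def e_def field_simps)
    qed
    with st(5) have "real (ops st) \<le> 1/2 * (c^2 + 23 * c) * M n * log 2 (real n) + e n"
      by linarith
    then show "\<exists>st F. in_place_interpol c_pi P n \<sigma> = Some st \<and>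
        has_size n F \<and> interpolates F as ys \<and>
        (\<forall>F'. has_size n F' \<and> interpolates F' as ys \<longrightarrow> F' = F) \<and>
        holds_output n F (memory st) \<and>
        (\<forall>j. memory st (Inp j) = \<sigma> (Inp j)) \<and>
        finite (extra_regs st) \<and> card (extra_regs st) \<le> B \<and>
        real (ops st) \<le> 1/2 * (c^2 + 23 * c) * M n * log 2 (real n) + e n"
      using st(1-3) regs F unique by blast
  qed
qed

end
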